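(* Let $f:\mathbb{R}^n\to\mathbb{R}\cup\{\infty\}$ be continuously differentiable, let $g$ be a sharp-peak function with constant $c>0$, let $\varphi(\mathbf{x})=\sum_{i=1}^n g(x_i)$, let $\mathbb{B}=[0,1]^n$, and let $\mu>\overline{\mu}:=\max_{\mathbf{x}\in\mathbb{B}}\|\nabla f(\mathbf{x})\|_\infty/c$. The following statements hold for the problem $\min_{\mathbf{x}\in\mathbb{B}}F(\mathbf{x};\mu):=f(\mathbf{x})+\mu\varphi(\mathbf{x})$: 1) Any KKT point is binary, i.e. belongs to $\{0,1\}^n$. 2) A KKT point is a local minimizer if $f$ and $\varphi$ are locally convex around this point. 3) A local minimizer is also a KKT point.
   Context: Let $B=[0,1]$ and $\mathbb{B}=[0,1]^n$. $\partial$ denotes the limiting subdifferential (Rockafellar–Wets, Definition 8.3), $N_{C}(\cdot)$ the normal cone of a convex set $C$, and $\delta_C$ the indicator function of $C$ ($0$ on $C$, $+\infty$ off $C$). Sharp-peak function (SPF): $g:\mathbb{R}\to\mathbb{R}\cup\{\infty\}$ is an SPF if (c1) for any $x\in B$, $g(x)\geq 0$, and $g(x)=0$ if and only if $x\in\{0,1\}$; (c2) $g$ is lower semi-continuous on $B$ and there is a constant $c>0$ with $|\nu|\geq c$ for all $\nu\in\partial g(x)$ and all $x\in B$ ($\partial g(x)=\emptyset$ is allowed); (c3) $\partial(g+\delta_B)(x)=\partial g(x)+N_B(x)$ for any $x\in\{0,1\}$. The constant $c$ in the definition of $\overline{\mu}$ is the constant from (c2). KKT point: $\widetilde{\mathbf{x}}\in\mathbb{B}$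 is a KKT point of $\min_{\mathbf{x}\in\mathbb{B}}f(\mathbf{x})+\mu\varphi(\mathbf{x})$ if $0\in\nabla f(\widetilde{\mathbf{x}})+\mu\,\partial\varphi(\widetilde{\mathbf{x}})+N_{\mathbb{B}}(\widetilde{\mathbf{x}})$. "Locally convex around a point" means convex on a neighbourhood of that point. Local minimizers are understood for the problem constrained to $\mathbb{B}$. *)

theory Defs
  imports "HOL-Analysis.Analysis" "HOL-Library.Set_Algebras"
begin

text \<open>
  Subdifferentials follow Rockafellar--Wets, \<^emph>\<open>Variational Analysis\<close>, Definition 8.3.  The condition
  \<open>f x \<ge> f x0 + \<langle>v, x - x0\<rangle> + o(\<parallel>x - x0\<parallel>)\<close> is one-sided there and stands for the lower limit below.
  Both sets are empty where \<open>f\<close> is not finite.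
\<close>

definition regular_subdifferential :: "('a::euclidean_space \<Rightarrow> ereal) \<Rightarrow> 'a \<Rightarrow> 'a set" where
  "regular_subdifferential f x0 =
    {v. \<bar>f x0\<bar> \<noteq> \<infinity> \<and>
        0 \<le> Liminf (at x0) (\<lambda>x. (f x - f x0 - ereal (v \<bullet> (x - x0))) / ereal (norm (x - x0)))}"

definition subdifferential :: "('a::euclidean_space \<Rightarrow> ereal) \<Rightarrow> 'a \<Rightarrow> 'a set" where
  "subdifferential f x0 =
    {v. \<bar>f x0\<bar> \<noteq> \<infinity> \<and>
        (\<exists>X V. X \<longlonglongrightarrow> x0 \<and> (\<lambda>k. f (X k)) \<longlonglongrightarrow> f x0 \<and>
               (\<forall>k. V k \<in> regular_subdifferential f (X k)) \<and> V \<longlonglongrightarrow> v)}"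

definition normal_cone :: "'a::euclidean_space set \<Rightarrow> 'a \<Rightarrow> 'a set" where
  "normal_cone C x = {w. x \<in> C \<and> (\<forall>y\<in>C. w \<bullet> (y - x) \<le> 0)}"

definition indicator_fun :: "'a set \<Rightarrow> 'a \<Rightarrow> ereal" where
  "indicator_fun C x = (if x \<in> C then 0 else \<infinity>)"

definition lsc_on :: "'a::topological_space set \<Rightarrow> ('a \<Rightarrow> ereal) \<Rightarrow> bool" where
  "lsc_on S f \<longleftrightarrow> (\<forall>x\<in>S. f x \<le> Liminf (at x within S) f)"

text \<open>
  An extended-valued \<open>f\<close> is differentiated through its real part; this is meaningful on open sets on
  which \<open>f\<close> is finite, as required in the definition of continuous differentiability.
\<close>

definition gradient :: "('a::euclidean_space \<Rightarrow> ereal) \<Rightarrow> 'a \<Rightarrow> 'a" where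
  "gradient f x = (THE D. GDERIV (\<lambda>y. real_of_ereal (f y)) x :> D)"

definition continuously_differentiable_on ::
    "'a::euclidean_space set \<Rightarrow> ('a \<Rightarrow> ereal) \<Rightarrow> bool" where
  "continuously_differentiable_on U f \<longleftrightarrow>
     open U \<and>
     (\<forall>x\<in>U. \<bar>f x\<bar> \<noteq> \<infinity> \<and> (\<exists>D. GDERIV (\<lambda>y. real_of_ereal (f y)) x :> D)) \<and>
     continuous_on U (gradient f)"

definition ereal_convex_on :: "'a::real_vector set \<Rightarrow> ('a \<Rightarrow> ereal) \<Rightarrow> bool" where
  "ereal_convex_on S f \<longleftrightarrow>
     convex S \<and>
     (\<forall>x\<in>S. \<forall>y\<in>S. \<forall>t\<in>{0..1}.
        f ((1 - t) *\<^sub>R x + t *\<^sub>R y) \<le> ereal (1 - t) * f x + ereal t * f y)"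

definition locally_convex_around :: "('a::real_normed_vector \<Rightarrow> ereal) \<Rightarrow> 'a \<Rightarrow> bool" where
  "locally_convex_around f x \<longleftrightarrow> (\<exists>S. open S \<and> x \<in> S \<and> ereal_convex_on S f)"

definition unit_box :: "(real ^ 'n) set" where
  "unit_box = {x. \<forall>i. x $ i \<in> {0..1}}"

text \<open>The first conjunct says that \<open>g\<close> takes values in \<open>\<real> \<union> {\<infinity>}\<close>.\<close>

definition sharp_peak :: "(real \<Rightarrow> ereal) \<Rightarrow> real \<Rightarrow> bool" where
  "sharp_peak g c \<longleftrightarrow>
     (\<forall>x. g x \<noteq> -\<infinity>) \<and>
     (\<forall>x\<in>{0..1}. g x \<ge> 0 \<and> (g x = 0 \<longleftrightarrow> x \<in> {0, 1})) \<and>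
     lsc_on {0..1} g \<and>
     c > 0 \<and> (\<forall>x\<in>{0..1}. \<forall>\<nu>\<in>subdifferential g x. \<bar>\<nu>\<bar> \<ge> c) \<and>
     (\<forall>x\<in>{0, 1}. subdifferential (\<lambda>y. g y + indicator_fun {0..1} y) x
                   = subdifferential g x + normal_cone {0..1} x)"

definition separable_sum :: "(real \<Rightarrow> ereal) \<Rightarrow> real ^ 'n \<Rightarrow> ereal" where
  "separable_sum g x = (\<Sum>i\<in>UNIV. g (x $ i))"

text \<open>For continuous \<open>gradient f\<close> the supremum over the compact box is a maximum;
  \<^const>\<open>infnorm\<close> is the \<open>\<ell>\<^sub>\<infinity>\<close> norm.\<close>

definition mu_bar :: "(real ^ 'n \<Rightarrow> ereal) \<Rightarrow> real \<Rightarrow> real" where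
  "mu_bar f c = (SUP x\<in>unit_box. infnorm (gradient f x)) / c"

definition penalized ::
    "('a \<Rightarrow> ereal) \<Rightarrow> ('a \<Rightarrow> ereal) \<Rightarrow> real \<Rightarrow> 'a \<Rightarrow> ereal" where
  "penalized f \<phi> \<mu> x = f x + ereal \<mu> * \<phi> x"

definition KKT_point ::
    "(real ^ 'n \<Rightarrow> ereal) \<Rightarrow> (real ^ 'n \<Rightarrow> ereal) \<Rightarrow> real \<Rightarrow> real ^ 'n \<Rightarrow> bool" where
  "KKT_point f \<phi> \<mu> x \<longleftrightarrow>
     x \<in> unit_box \<and>
     0 \<in> {gradient f x} + (\<lambda>v. \<mu> *\<^sub>R v) ` subdifferential \<phi> x + normal_cone unit_box x"

text \<open>
  As usual for extended-valued objectives, a local minimizer has a finite objective value: a point of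
  an open region where \<open>F\<close> is identically \<open>\<infinity>\<close> is not one.
\<close>

definition local_minimizer_on :: "'a::topological_space set \<Rightarrow> ('a \<Rightarrow> ereal) \<Rightarrow> 'a \<Rightarrow> bool" where
  "local_minimizer_on C F x \<longleftrightarrow>
     x \<in> C \<and> \<bar>F x\<bar> \<noteq> \<infinity> \<and> (\<forall>\<^sub>F y in at x within C. F x \<le> F y)"

end

theory Submission
  imports Defs
begin

text \<open>
  Write \<open>\<phi>\<close> for the separable penalty built from the sharp-peak function \<open>g\<close>.  The bound on \<open>\<mu>\<close>
  says that every partial derivative of \<open>f\<close> on the box is smaller in absolute value than \<open>\<mu> * c\<close>,
  whereas every subgradient of \<open>\<mu> * g\<close> on the unit interval has absolute value at least \<open>\<mu> * c\<close>.

  A KKT point is therefore binary: in a coordinate strictly between 0 and 1 the normal cone vanishes,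
  so the equation \<open>gradient f x $ i + \<mu> * v $ i = 0\<close> would balance a small number against a large
  one (\<open>KKT_point_binary\<close>).

  If \<open>f\<close> and \<open>\<phi>\<close> are convex near a KKT point, the gradient of \<open>f\<close> and the subgradient of \<open>\<phi>\<close>
  give affine minorants on a whole neighbourhood (\<open>subgradient_inequality\<close>).  Their weighted sum
  has slope \<open>- w\<close> with \<open>w\<close> normal to the box, so on the box it never falls below its value at the point
  (\<open>convex_KKT_point_local_minimizer\<close>).

  At a local minimizer, the scaled negative gradient of \<open>f\<close> is a regular subgradient of \<open>\<phi>\<close> plus the
  indicator of the box (\<open>regular_subdifferential_at_local_minimizer\<close>).  This function is again a
  separable sum, with summand \<open>g\<close> plus the indicator of the unit interval, so the statement splits
  into coordinates, and in each coordinate the sum rule demanded of a sharp-peak function separates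
  a limiting subgradient of \<open>g\<close> from a normal vector.  Limiting subgradients of \<open>g\<close> in the single
  coordinates recombine to one of \<open>\<phi>\<close> (\<open>subdifferential_separable_sum_vec\<close>), and the normal vectors
  recombine because the box is a product.
\<close>

section \<open>Regular and limiting subgradients\<close>

text \<open>
  The lower limit of difference quotients, rewritten without division.  The inequality holds
  trivially at \<open>x0\<close> itself, so the punctured neighbourhood may be replaced by a full one; this lets
  it be pulled back along maps that hit \<open>x0\<close>, such as coordinate projections.
\<close>

lemma mem_regular_subdifferential_iff:
  "v \<in> regular_subdifferential f x0 \<longleftrightarrow>
    (\<exists>a. f x0 = ereal a \<and>
      (\<forall>\<epsilon>>0. \<forall>\<^sub>F x in nhds x0. ereal (a + v \<bullet> (x - x0) - \<epsilon> * norm (x - x0)) \<le> f x))"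
proof (cases "f x0")
  case (real a)
  let ?q = "\<lambda>x. (f x - f x0 - ereal (v \<bullet> (x - x0))) / ereal (norm (x - x0))"
  let ?l = "\<lambda>\<epsilon> x. ereal (a + v \<bullet> (x - x0) - \<epsilon> * norm (x - x0))"
  have quot: "ereal (- \<epsilon>) < ?q x \<longleftrightarrow> ?l \<epsilon> x < f x" if "x \<noteq> x0" for x \<epsilon>
    using that real by (cases "f x") (auto simp: field_simps)
  have "0 \<le> Liminf (at x0) ?q \<longleftrightarrow> (\<forall>\<epsilon>>0. \<forall>\<^sub>F x in at x0. ?l \<epsilon> x < f x)"
    (is "?L \<longleftrightarrow> ?R")
  proof
    assume L: ?L
    show ?R
    proof (intro allI impI)
      fix \<epsilon> :: real assume "\<epsilon> > 0"
      then have "ereal (- \<epsilon>) < 0" by simp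
      with L have "\<forall>\<^sub>F x in at x0. ereal (- \<epsilon>) < ?q x" unfolding le_Liminf_iff by blast
      moreover have "\<forall>\<^sub>F x in at x0. x \<noteq> x0" by (simp add: eventually_at_filter)
      ultimately show "\<forall>\<^sub>F x in at x0. ?l \<epsilon> x < f x"
        by eventually_elim (simp add: quot)
    qed
  next
    assume R: ?R
    show ?L unfolding le_Liminf_iff
    proof (intro allI impI)
      fix y :: ereal assume "y < 0"
      then obtain \<epsilon> where e: "\<epsilon> > 0" "y \<le> ereal (- \<epsilon>)"
        by (cases y) (auto intro: that[of 1] simp: that[of "- real_of_ereal y"])
      from R e have "\<forall>\<^sub>F x in at x0. ?l \<epsilon> x < f x" by blast
      moreover have "\<forall>\<^sub>F x in at x0. x \<noteq> x0" by (simp add: eventually_at_filter)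
      ultimately show "\<forall>\<^sub>F x in at x0. y < ?q x"
        by eventually_elim (use e quot in \<open>auto intro: le_less_trans\<close>)
    qed
  qed
  also have "\<dots> \<longleftrightarrow> (\<forall>\<epsilon>>0. \<forall>\<^sub>F x in nhds x0. ?l \<epsilon> x \<le> f x)"
  proof (intro iffI allI impI)
    fix \<epsilon> :: real assume "\<epsilon> > 0" "\<forall>\<epsilon>>0. \<forall>\<^sub>F x in at x0. ?l \<epsilon> x < f x"
    then have "\<forall>\<^sub>F x in nhds x0. x \<noteq> x0 \<longrightarrow> ?l \<epsilon> x < f x"
      by (simp add: eventually_at_filter)
    then show "\<forall>\<^sub>F x in nhds x0. ?l \<epsilon> x \<le> f x"
      by eventually_elim (use real in force)
  next
    fix \<epsilon> :: real assume "\<epsilon> > 0" and R: "\<forall>\<epsilon>>0. \<forall>\<^sub>F x in nhds x0. ?l \<epsilon> x \<le> f x"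
    \<comment> \<open>Half of the slack turns the weak inequality into a strict one off the centre.\<close>
    then have "\<forall>\<^sub>F x in nhds x0. ?l (\<epsilon> / 2) x \<le> f x"
      using half_gt_zero by blast
    then show "\<forall>\<^sub>F x in at x0. ?l \<epsilon> x < f x"
      unfolding eventually_at_filter
    proof eventually_elim
      case (elim x)
      show ?case
      proof
        assume "x \<noteq> x0"
        then have "?l \<epsilon> x < ?l (\<epsilon> / 2) x" using \<open>\<epsilon> > 0\<close> by simp
        with elim show "x \<in> UNIV \<longrightarrow> ?l \<epsilon> x < f x" by (metis less_ereal.simps(1) order.strict_trans2)
      qed
    qed
  qed
  finally show ?thesis using real by (simp add: regular_subdifferential_def)
qed (auto simp: regular_subdifferential_def)

lemma regular_subdifferential_subset: "regular_subdifferential f x \<subseteq> subdifferential f x"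
proof
  fix v assume v: "v \<in> regular_subdifferential f x"
  then have "\<bar>f x\<bar> \<noteq> \<infinity>" by (simp add: regular_subdifferential_def)
  moreover have "\<exists>X V. X \<longlonglongrightarrow> x \<and> (\<lambda>k::nat. f (X k)) \<longlonglongrightarrow> f x \<and>
               (\<forall>k. V k \<in> regular_subdifferential f (X k)) \<and> V \<longlonglongrightarrow> v"
    by (rule exI[of _ "\<lambda>_. x"], rule exI[of _ "\<lambda>_. v"]) (use v in simp)
  ultimately show "v \<in> subdifferential f x" by (simp add: subdifferential_def)
qed

lemma regular_subdifferential_eventually_cong:
  assumes "\<forall>\<^sub>F y in nhds x. f y = h y"
  shows "regular_subdifferential f x = regular_subdifferential h x"
proof -
  have "f x = h x" using assms by (rule eventually_nhds_x_imp_x)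
  moreover have "(\<forall>\<^sub>F y in nhds x. l y \<le> f y) \<longleftrightarrow> (\<forall>\<^sub>F y in nhds x. l y \<le> h y)" for l
    by (rule eventually_cong[OF assms]) simp
  ultimately show ?thesis
    by (intro set_eqI) (simp add: mem_regular_subdifferential_iff)
qed

section \<open>Convexity and differentiability\<close>

text \<open>
  Along the segment from \<open>x\<close> to \<open>y\<close> the function lies below its chord and, near \<open>x\<close>, above the line of
  slope \<open>v\<close> up to an error of first order; dividing by the parameter at one small point of the
  segment compares the slopes, up to an arbitrarily small error.
\<close>

lemma regular_subgradient_inequality:
  assumes conv: "ereal_convex_on S f" and S: "x \<in> S" "y \<in> S"
    and v: "v \<in> regular_subdifferential f x"
  shows "f x + ereal (v \<bullet> (y - x)) \<le> f y"
proof -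
  obtain a where a: "f x = ereal a"
    and lower: "\<And>\<epsilon>. \<epsilon> > 0 \<Longrightarrow>
      \<forall>\<^sub>F z in nhds x. ereal (a + v \<bullet> (z - x) - \<epsilon> * norm (z - x)) \<le> f z"
    using v unfolding mem_regular_subdifferential_iff by blast
  have bound: "ereal (a + v \<bullet> (y - x) - \<epsilon> * norm (y - x)) \<le> f y" if "\<epsilon> > 0" for \<epsilon>
  proof -
    have "((\<lambda>t. x + t *\<^sub>R (y - x)) \<longlongrightarrow> x + 0 *\<^sub>R (y - x)) (at_right 0)"
      by (intro tendsto_intros)
    then have "\<forall>\<^sub>F t in at_right 0. ereal (a + v \<bullet> (t *\<^sub>R (y - x)) - \<epsilon> * norm (t *\<^sub>R (y - x)))
        \<le> f (x + t *\<^sub>R (y - x))"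
      using lower[OF that] by (auto simp: filterlim_iff)
    moreover have "\<forall>\<^sub>F t in at_right (0::real). t < 1" "\<forall>\<^sub>F t in at_right (0::real). t > 0"
      by (auto simp: eventually_at_right_less intro: eventually_at_rightI[of 0 1])
    ultimately have "\<forall>\<^sub>F t in at_right 0. 0 < t \<and> t < 1 \<and>
        ereal (a + v \<bullet> (t *\<^sub>R (y - x)) - \<epsilon> * norm (t *\<^sub>R (y - x))) \<le> f (x + t *\<^sub>R (y - x))"
      by eventually_elim auto
    then obtain t where t: "0 < t" "t < 1"
      and le: "ereal (a + v \<bullet> (t *\<^sub>R (y - x)) - \<epsilon> * norm (t *\<^sub>R (y - x))) \<le> f (x + t *\<^sub>R (y - x))"
      using eventually_happens'[OF trivial_limit_at_right_real] by blast
    have "x + t *\<^sub>R (y - x) = (1 - t) *\<^sub>R x + t *\<^sub>R y" by (simp add: algebra_simps)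
    then have "f (x + t *\<^sub>R (y - x)) \<le> ereal (1 - t) * f x + ereal t * f y"
      using conv S t unfolding ereal_convex_on_def by auto
    with le have chord: "ereal (a + v \<bullet> (t *\<^sub>R (y - x)) - \<epsilon> * norm (t *\<^sub>R (y - x)))
        \<le> ereal (1 - t) * f x + ereal t * f y" by (rule order.trans)
    show ?thesis
    proof (cases "f y")
      case (real b)
      with chord a t
      have "a + t * (v \<bullet> (y - x)) - \<epsilon> * (t * norm (y - x)) \<le> (1 - t) * a + t * b"
        by simp
      then have "t * (a + v \<bullet> (y - x) - \<epsilon> * norm (y - x)) \<le> t * b"
        by (simp add: algebra_simps)
      with t real show ?thesis by simp
    qed (use chord a t in auto)
  qed
  show ?thesis
  proof (cases "f y")
    case (real b)
    have "a + v \<bullet> (y - x) \<le> b + e" if "e > 0" for e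
    proof -
      have pos: "1 + norm (y - x) > 0" by (rule add_pos_nonneg) auto
      \<comment> \<open>The 1 in the denominator covers the case \<open>y = x\<close>.\<close>
      then have "e / (1 + norm (y - x)) > 0" using that by simp
      from bound[OF this] real
      have "a + v \<bullet> (y - x) - e / (1 + norm (y - x)) * norm (y - x) \<le> b" by simp
      moreover have "e / (1 + norm (y - x)) * norm (y - x) \<le> e"
        using that pos by (simp add: field_simps)
      ultimately show ?thesis by simp
    qed
    then have "a + v \<bullet> (y - x) \<le> b" by (rule field_le_epsilon)
    with a real show ?thesis by simp
  qed (use bound[of 1] in auto)
qed

text \<open>
  The inequality holds at the points of an approximating sequence as soon as they enter the open set,
  and both sides survive the limit.
\<close>

lemma subgradient_inequality:
  assumes conv: "ereal_convex_on S f" and S: "open S" "x \<in> S" "y \<in> S"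
    and v: "v \<in> subdifferential f x"
  shows "f x + ereal (v \<bullet> (y - x)) \<le> f y"
proof -
  obtain X V where XV: "X \<longlonglongrightarrow> x" "(\<lambda>k. f (X k)) \<longlonglongrightarrow> f x"
      "\<And>k. V k \<in> regular_subdifferential f (X k)" "V \<longlonglongrightarrow> v"
    using v unfolding subdifferential_def by blast
  have fin: "\<bar>f x\<bar> \<noteq> \<infinity>" using v by (simp add: subdifferential_def)
  have "(\<lambda>k. V k \<bullet> (y - X k)) \<longlonglongrightarrow> v \<bullet> (y - x)"
    by (intro tendsto_inner tendsto_diff tendsto_const XV(1,4))
  then have "(\<lambda>k. f (X k) + ereal (V k \<bullet> (y - X k))) \<longlonglongrightarrow> f x + ereal (v \<bullet> (y - x))"
    by (intro tendsto_add_ereal tendsto_ereal) (use XV(2) fin in auto)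
  moreover have "\<forall>\<^sub>F k in sequentially. X k \<in> S"
    using XV(1) S by (simp add: topological_tendstoD)
  then have "\<forall>\<^sub>F k in sequentially. f (X k) + ereal (V k \<bullet> (y - X k)) \<le> f y"
    by eventually_elim (rule regular_subgradient_inequality[OF conv _ S(3) XV(3)])
  ultimately show ?thesis by (rule tendsto_upperbound) simp
qed

lemma GDERIV_gradient:
  assumes "continuously_differentiable_on U f" "x \<in> U"
  shows "GDERIV (\<lambda>y. real_of_ereal (f y)) x :> gradient f x"
proof -
  obtain D where D: "GDERIV (\<lambda>y. real_of_ereal (f y)) x :> D"
    using assms unfolding continuously_differentiable_on_def by blast
  have "D' = D" if "GDERIV (\<lambda>y. real_of_ereal (f y)) x :> D'" for D'
  proof -
    have "(\<lambda>h. h \<bullet> D') = (\<lambda>h. h \<bullet> D)"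
      using that D unfolding gderiv_def by (rule has_derivative_unique)
    then show ?thesis by (metis (no_types) vector_eq_ldot)
  qed
  with D show ?thesis unfolding gradient_def by (rule theI[where a = D])
qed

lemma gradient_linear_approximation:
  assumes f: "continuously_differentiable_on U f" "x \<in> U" and "\<epsilon> > 0"
  shows "\<forall>\<^sub>F y in nhds x. \<bar>f y\<bar> \<noteq> \<infinity> \<and>
    \<bar>real_of_ereal (f y) - real_of_ereal (f x) - gradient f x \<bullet> (y - x)\<bar> \<le> \<epsilon> * norm (y - x)"
proof -
  have "\<forall>\<^sub>F y in nhds x. y \<in> U"
    using f by (simp add: continuously_differentiable_on_def eventually_nhds_in_open)
  then have "\<forall>\<^sub>F y in nhds x. \<bar>f y\<bar> \<noteq> \<infinity>"
    by eventually_elim (use f in \<open>simp add: continuously_differentiable_on_def\<close>)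
  moreover obtain d where "d > 0" and d: "\<And>y. norm (y - x) < d \<Longrightarrow>
      norm (real_of_ereal (f y) - real_of_ereal (f x) - (y - x) \<bullet> gradient f x) \<le> \<epsilon> * norm (y - x)"
    using GDERIV_gradient[OF f] \<open>\<epsilon> > 0\<close> unfolding gderiv_def has_derivative_at_alt by blast
  then have "\<forall>\<^sub>F y in nhds x.
      \<bar>real_of_ereal (f y) - real_of_ereal (f x) - gradient f x \<bullet> (y - x)\<bar> \<le> \<epsilon> * norm (y - x)"
    unfolding eventually_nhds_metric by (auto simp: dist_norm inner_commute)
  ultimately show ?thesis by (rule eventually_conj)
qed

lemma gradient_in_regular_subdifferential:
  assumes f: "continuously_differentiable_on U f" "x \<in> U"
  shows "gradient f x \<in> regular_subdifferential f x"
  unfolding mem_regular_subdifferential_iff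
proof (intro exI[of _ "real_of_ereal (f x)"] conjI allI impI)
  show "f x = ereal (real_of_ereal (f x))"
    using f by (simp add: continuously_differentiable_on_def ereal_real)
  fix \<epsilon> :: real assume "\<epsilon> > 0"
  from gradient_linear_approximation[OF f this]
  show "\<forall>\<^sub>F y in nhds x.
      ereal (real_of_ereal (f x) + gradient f x \<bullet> (y - x) - \<epsilon> * norm (y - x)) \<le> f y"
  proof eventually_elim
    case (elim y)
    then show ?case by (cases "f y") auto
  qed
qed

text \<open>
  The generalized Fermat rule with the smooth part moved to the other side: minimality bounds \<open>\<mu> * \<phi>\<close>
  from below by a constant minus \<open>f\<close>, and \<open>f\<close> is linear up to an error of first order.
\<close>

lemma regular_subdifferential_at_local_minimizer:
  fixes \<phi> :: "'a::euclidean_space \<Rightarrow> ereal"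
  assumes f: "continuously_differentiable_on U f" "x \<in> U" and "\<mu> > 0"
    and min: "local_minimizer_on C (penalized f \<phi> \<mu>) x"
  shows "- (gradient f x /\<^sub>R \<mu>) \<in> regular_subdifferential (\<lambda>y. \<phi> y + indicator_fun C y) x"
proof -
  have "x \<in> C" and fin: "\<bar>penalized f \<phi> \<mu> x\<bar> \<noteq> \<infinity>"
    and ev: "\<forall>\<^sub>F y in nhds x. y \<noteq> x \<longrightarrow> y \<in> C \<longrightarrow> penalized f \<phi> \<mu> x \<le> penalized f \<phi> \<mu> y"
    using min unfolding local_minimizer_on_def eventually_at_filter by auto
  define a where "a = real_of_ereal (f x)"
  have a: "f x = ereal a"
    using f by (simp add: a_def continuously_differentiable_on_def ereal_real)
  obtain p where p: "\<phi> x = ereal p"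
    using fin a \<open>\<mu> > 0\<close> by (cases "\<phi> x") (auto simp: penalized_def)
  show ?thesis
    unfolding mem_regular_subdifferential_iff
  proof (intro exI[of _ p] conjI allI impI)
    show "\<phi> x + indicator_fun C x = ereal p"
      using p \<open>x \<in> C\<close> by (simp add: indicator_fun_def)
    fix \<epsilon> :: real assume "\<epsilon> > 0"
    \<comment> \<open>The final division by \<open>\<mu>\<close> turns the linearization error \<open>\<mu> * \<epsilon>\<close> into \<open>\<epsilon>\<close>.\<close>
    then have "\<mu> * \<epsilon> > 0" using \<open>\<mu> > 0\<close> by simp
    from ev gradient_linear_approximation[OF f this]
    show "\<forall>\<^sub>F y in nhds x. ereal (p + - (gradient f x /\<^sub>R \<mu>) \<bullet> (y - x) - \<epsilon> * norm (y - x))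
        \<le> \<phi> y + indicator_fun C y"
    proof eventually_elim
      case (elim y)
      then obtain b where b: "f y = ereal b" by (cases "f y") auto
      show ?case
      proof (cases "y \<in> C \<and> y \<noteq> x")
        case True
        with elim have le: "ereal a + ereal \<mu> * ereal p \<le> ereal b + ereal \<mu> * \<phi> y"
          by (simp add: penalized_def a b p)
        show ?thesis
        proof (cases "\<phi> y")
          case (real q)
          have "b - a - gradient f x \<bullet> (y - x) \<le> \<mu> * \<epsilon> * norm (y - x)"
            using elim by (auto simp: b a)
          moreover have "a + \<mu> * p \<le> b + \<mu> * q" using le real by simp
          ultimately have "\<mu> * p - gradient f x \<bullet> (y - x) - \<mu> * \<epsilon> * norm (y - x) \<le> \<mu> * q" by simp
          then have "p - gradient f x \<bullet> (y - x) / \<mu> - \<epsilon> * norm (y - x) \<le> q"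
            using \<open>\<mu> > 0\<close> by (simp add: field_simps)
          then show ?thesis
            using real True by (simp add: indicator_fun_def divide_inverse mult.commute)
        qed (use le \<open>\<mu> > 0\<close> in auto)
      next
        case False
        then show ?thesis
          using p \<open>x \<in> C\<close> by (cases "\<phi> y") (auto simp: indicator_fun_def)
      qed
    qed
  qed
qed

section \<open>Separable sums\<close>

lemma separable_sum_ereal:
  assumes "\<And>i. g (x $ i) = ereal (r i)"
  shows "separable_sum g x = ereal (\<Sum>i\<in>UNIV. r i)"
  unfolding separable_sum_def assms by simp

lemma separable_sum_finite_component:
  assumes "\<And>t. g t \<noteq> -\<infinity>" "\<bar>separable_sum g x\<bar> \<noteq> \<infinity>"
  shows "\<bar>g (x $ i)\<bar> \<noteq> \<infinity>"
proof -
  have "g (x $ i) \<noteq> \<infinity>"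
  proof
    assume "g (x $ i) = \<infinity>"
    then have "separable_sum g x = \<infinity>" unfolding separable_sum_def sum_Pinfty by auto
    with assms(2) show False by simp
  qed
  with assms(1) show ?thesis by auto
qed

text \<open>
  Moving only coordinate \<open>i\<close> leaves all other summands at their values at \<open>x\<close>.  These are finite, since
  the sum is, and cancel from the inequality.
\<close>

lemma regular_subdifferential_separable_sum_component:
  fixes x v :: "real ^ 'n"
  assumes g: "\<And>t. g t \<noteq> -\<infinity>" and v: "v \<in> regular_subdifferential (separable_sum g) x"
  shows "v $ i \<in> regular_subdifferential g (x $ i)"
proof -
  obtain a where a: "separable_sum g x = ereal a"
    and lower: "\<And>\<epsilon>. \<epsilon> > 0 \<Longrightarrow> \<forall>\<^sub>F z in nhds x.
      ereal (a + v \<bullet> (z - x) - \<epsilon> * norm (z - x)) \<le> separable_sum g z"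
    using v unfolding mem_regular_subdifferential_iff by blast
  define r where "r j = real_of_ereal (g (x $ j))" for j
  have r: "g (x $ j) = ereal (r j)" for j
    using separable_sum_finite_component[where g = g, OF g, of x j] a by (simp add: r_def ereal_real)
  define R where "R = (\<Sum>j\<in>UNIV - {i}. r j)"
  have a_split: "a = r i + R"
    using a separable_sum_ereal[of g x r, OF r] by (simp add: R_def sum.remove[of _ i])
  define line where "line t = x + (t - x $ i) *\<^sub>R axis i 1" for t
  have line_nth: "line t $ j = (if j = i then t else x $ j)" for t j
    by (simp add: line_def axis_def)
  have sum_line: "separable_sum g (line t) = g t + ereal R" for t
    by (simp add: separable_sum_def sum.remove[of UNIV i] line_nth r R_def)
  have "(line \<longlongrightarrow> x + (x $ i - x $ i) *\<^sub>R axis i 1) (nhds (x $ i))"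
    unfolding line_def by (intro tendsto_intros filterlim_ident)
  then have lim: "filterlim line (nhds x) (nhds (x $ i))" by simp
  show ?thesis
    unfolding mem_regular_subdifferential_iff
  proof (intro exI[of _ "r i"] conjI allI impI)
    fix \<epsilon> :: real assume "\<epsilon> > 0"
    from lower[OF this] lim
    have "\<forall>\<^sub>F t in nhds (x $ i).
        ereal (a + v \<bullet> (line t - x) - \<epsilon> * norm (line t - x)) \<le> separable_sum g (line t)"
      by (auto simp: filterlim_iff)
    then show "\<forall>\<^sub>F t in nhds (x $ i).
        ereal (r i + v $ i \<bullet> (t - x $ i) - \<epsilon> * norm (t - x $ i)) \<le> g t"
    proof eventually_elim
      case (elim t)
      then have "ereal (r i + R + (t - x $ i) * v $ i - \<epsilon> * \<bar>t - x $ i\<bar>) \<le> g t + ereal R"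
        unfolding sum_line a_split by (simp add: line_def inner_axis mult.commute)
      then show ?case by (cases "g t") (auto simp: mult.commute)
    qed
  qed (rule r)
qed

lemma regular_subdifferential_separable_sum_vec:
  fixes x v :: "real ^ 'n"
  assumes v: "\<And>i. v $ i \<in> regular_subdifferential g (x $ i)"
  shows "v \<in> regular_subdifferential (separable_sum g) x"
proof -
  have "\<forall>i. \<exists>a. g (x $ i) = ereal a \<and> (\<forall>\<epsilon>>0. \<forall>\<^sub>F t in nhds (x $ i).
      ereal (a + v $ i \<bullet> (t - x $ i) - \<epsilon> * norm (t - x $ i)) \<le> g t)"
    using v unfolding mem_regular_subdifferential_iff by blast
  then obtain r where r: "\<And>i. g (x $ i) = ereal (r i)"
    and lower: "\<And>i \<epsilon>. \<epsilon> > 0 \<Longrightarrow> \<forall>\<^sub>F t in nhds (x $ i).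
      ereal (r i + v $ i * (t - x $ i) - \<epsilon> * \<bar>t - x $ i\<bar>) \<le> g t"
    unfolding choice_iff by auto
  show ?thesis
    unfolding mem_regular_subdifferential_iff
  proof (intro exI[of _ "\<Sum>i\<in>UNIV. r i"] conjI allI impI)
    show "separable_sum g x = ereal (\<Sum>i\<in>UNIV. r i)" by (rule separable_sum_ereal) (rule r)
    fix \<epsilon> :: real assume "\<epsilon> > 0"
    \<comment> \<open>Every coordinate gets an equal share of the slack, since each \<open>\<bar>z $ i - x $ i\<bar>\<close> can be as
      large as the norm.\<close>
    define \<delta> where "\<delta> = \<epsilon> / real CARD('n)"
    have "\<delta> > 0" using \<open>\<epsilon> > 0\<close> by (simp add: \<delta>_def)
    have "\<forall>\<^sub>F z in nhds x. ereal (r i + v $ i * (z $ i - x $ i) - \<delta> * \<bar>z $ i - x $ i\<bar>) \<le> g (z $ i)"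
      for i
    proof -
      have "filterlim (\<lambda>z. z $ i) (nhds (x $ i)) (nhds x)"
        by (intro tendsto_vec_nth filterlim_ident)
      with lower[OF \<open>\<delta> > 0\<close>, of i] show ?thesis by (auto simp: filterlim_iff)
    qed
    then have "\<forall>\<^sub>F z in nhds x. \<forall>i.
        ereal (r i + v $ i * (z $ i - x $ i) - \<delta> * \<bar>z $ i - x $ i\<bar>) \<le> g (z $ i)"
      by (rule eventually_all_finite)
    then show "\<forall>\<^sub>F z in nhds x. ereal ((\<Sum>i\<in>UNIV. r i) + v \<bullet> (z - x) - \<epsilon> * norm (z - x))
        \<le> separable_sum g z"
    proof eventually_elim
      case (elim z)
      have "(\<Sum>i\<in>UNIV. \<delta> * \<bar>z $ i - x $ i\<bar>) \<le> (\<Sum>i\<in>(UNIV::'n set). \<delta> * norm (z - x))"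
        by (intro sum_mono mult_left_mono)
          (use \<open>\<delta> > 0\<close> component_le_norm_cart[of "z - x"] in auto)
      also have "\<dots> = \<epsilon> * norm (z - x)" by (simp add: \<delta>_def)
      finally have "(\<Sum>i\<in>UNIV. r i) + v \<bullet> (z - x) - \<epsilon> * norm (z - x)
          \<le> (\<Sum>i\<in>UNIV. r i + v $ i * (z $ i - x $ i) - \<delta> * \<bar>z $ i - x $ i\<bar>)"
        by (simp add: inner_vec_def sum.distrib sum_subtractf)
      then have "ereal ((\<Sum>i\<in>UNIV. r i) + v \<bullet> (z - x) - \<epsilon> * norm (z - x))
          \<le> (\<Sum>i\<in>UNIV. ereal (r i + v $ i * (z $ i - x $ i) - \<delta> * \<bar>z $ i - x $ i\<bar>))"
        by simp
      also have "\<dots> \<le> separable_sum g z"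
        unfolding separable_sum_def by (intro sum_mono) (use elim in blast)
      finally show ?case .
    qed
  qed
qed

text \<open>
  Approximating sequences of the coordinates are run in parallel; the function values converge
  because a sum of finitely many convergent finite sequences converges.
\<close>

lemma subdifferential_separable_sum_vec:
  fixes x v :: "real ^ 'n"
  assumes v: "\<And>i. v $ i \<in> subdifferential g (x $ i)"
  shows "v \<in> subdifferential (separable_sum g) x"
proof -
  have "\<forall>i. \<exists>X V. X \<longlonglongrightarrow> x $ i \<and> (\<lambda>k. g (X k)) \<longlonglongrightarrow> g (x $ i) \<and>
      (\<forall>k. V k \<in> regular_subdifferential g (X k)) \<and> V \<longlonglongrightarrow> v $ i"
    using v unfolding subdifferential_def by blast
  then obtain X V where XV: "\<And>i. X i \<longlonglongrightarrow> x $ i" "\<And>i. (\<lambda>k. g (X i k)) \<longlonglongrightarrow> g (x $ i)"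
      "\<And>i k. V i k \<in> regular_subdifferential g (X i k)" "\<And>i. V i \<longlonglongrightarrow> v $ i"
    unfolding choice_iff by blast
  have fin: "\<bar>g (x $ i)\<bar> \<noteq> \<infinity>" for i using v[of i] by (simp add: subdifferential_def)
  then have r: "g (x $ i) = ereal (real_of_ereal (g (x $ i)))" for i
    by (simp add: ereal_real)
  have rk: "g (X i k) = ereal (real_of_ereal (g (X i k)))" for i k
    using XV(3)[of i k] by (simp add: regular_subdifferential_def ereal_real)
  define X' where "X' k = (\<chi> i. X i k)" for k
  define V' where "V' k = (\<chi> i. V i k)" for k
  have "X' \<longlonglongrightarrow> x" "V' \<longlonglongrightarrow> v"
    by (auto intro!: vec_tendstoI simp: X'_def V'_def XV)
  moreover have "(\<lambda>k. separable_sum g (X' k)) \<longlonglongrightarrow> separable_sum g x"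
  proof -
    have "(\<lambda>k. ereal (\<Sum>i\<in>UNIV. real_of_ereal (g (X i k))))
        \<longlonglongrightarrow> ereal (\<Sum>i\<in>UNIV. real_of_ereal (g (x $ i)))"
      by (intro tendsto_ereal tendsto_sum lim_real_of_ereal) (metis XV(2) r)
    moreover have "separable_sum g (X' k) = ereal (\<Sum>i\<in>UNIV. real_of_ereal (g (X i k)))" for k
      by (rule separable_sum_ereal) (simp add: X'_def rk[symmetric])
    ultimately show ?thesis
      using separable_sum_ereal[of g x, OF r] by simp
  qed
  moreover have "\<forall>k. V' k \<in> regular_subdifferential (separable_sum g) (X' k)"
    by (auto intro!: regular_subdifferential_separable_sum_vec simp: X'_def V'_def XV)
  moreover have "\<bar>separable_sum g x\<bar> \<noteq> \<infinity>"
    using separable_sum_ereal[of g x, OF r] by simp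
  ultimately show ?thesis
    unfolding subdifferential_def mem_Collect_eq by blast
qed

section \<open>The unit box\<close>

lemma unit_box_eq_cbox: "unit_box = cbox 0 1"
  by (simp add: set_eq_iff unit_box_def mem_box_cart)

lemma normal_cone_interior_unit_interval:
  assumes "0 < t" "t < (1::real)" "w \<in> normal_cone {0..1} t"
  shows "w = 0"
proof -
  have "\<forall>y\<in>{0..1}. w * (y - t) \<le> 0"
    using assms by (simp add: normal_cone_def)
  from bspec[OF this, of 0] bspec[OF this, of 1]
  have "0 \<le> w * t" "w * (1 - t) \<le> 0" by simp_all
  with assms(1,2) show ?thesis by (simp add: mult_le_0_iff zero_le_mult_iff)
qed

lemma normal_cone_unit_box_iff:
  "w \<in> normal_cone unit_box x \<longleftrightarrow> (\<forall>i. w $ i \<in> normal_cone {0..1} (x $ i))"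
proof
  assume w: "w \<in> normal_cone unit_box x"
  then have x: "x \<in> unit_box" by (simp add: normal_cone_def)
  show "\<forall>i. w $ i \<in> normal_cone {0..1} (x $ i)"
  proof
    fix i
    have "w $ i * (t - x $ i) \<le> 0" if "t \<in> {0..1}" for t
    proof -
      have "x + (t - x $ i) *\<^sub>R axis i 1 \<in> unit_box"
        using x that by (simp add: unit_box_def axis_def)
      with w have "w \<bullet> (x + (t - x $ i) *\<^sub>R axis i 1 - x) \<le> 0"
        unfolding normal_cone_def by blast
      then show ?thesis by (simp add: inner_axis mult.commute)
    qed
    with x show "w $ i \<in> normal_cone {0..1} (x $ i)"
      by (simp add: normal_cone_def unit_box_def)
  qed
next
  assume "\<forall>i. w $ i \<in> normal_cone {0..1} (x $ i)"
  then show "w \<in> normal_cone unit_box x"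
    by (auto simp: normal_cone_def unit_box_def inner_vec_def intro!: sum_nonpos)
qed

lemma separable_sum_add_indicator_unit_box:
  fixes x :: "real ^ 'n"
  assumes g: "\<And>t. g t \<noteq> -\<infinity>"
  shows "separable_sum g x + indicator_fun unit_box x
    = separable_sum (\<lambda>t. g t + indicator_fun {0..1} t) x"
proof -
  have "indicator_fun unit_box x = separable_sum (indicator_fun {0..1}) x"
  proof (cases "x \<in> unit_box")
    case False
    then have "\<exists>i\<in>UNIV. indicator_fun {0..1} (x $ i) = \<infinity>"
      by (auto simp: indicator_fun_def unit_box_def)
    then have "separable_sum (indicator_fun {0..1}) x = \<infinity>"
      unfolding separable_sum_def sum_Pinfty by simp
    with False show ?thesis by (simp add: indicator_fun_def)
  qed (simp add: indicator_fun_def separable_sum_def unit_box_def)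
  then show ?thesis by (simp add: separable_sum_def sum.distrib)
qed

section \<open>KKT points and bounded gradients\<close>

lemma KKT_pointE:
  assumes "KKT_point f \<phi> \<mu> x"
  obtains v w where "v \<in> subdifferential \<phi> x" "w \<in> normal_cone unit_box x"
    "gradient f x + \<mu> *\<^sub>R v + w = 0"
proof -
  from assms have "0 \<in> {gradient f x} + (\<lambda>v. \<mu> *\<^sub>R v) ` subdifferential \<phi> x + normal_cone unit_box x"
    by (simp add: KKT_point_def)
  then obtain s w where s: "s \<in> {gradient f x} + (\<lambda>v. \<mu> *\<^sub>R v) ` subdifferential \<phi> x"
    and w: "w \<in> normal_cone unit_box x" "0 = s + w"
    by (rule set_plus_elim)
  from s obtain v where "v \<in> subdifferential \<phi> x" "s = gradient f x + \<mu> *\<^sub>R v"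
    by (auto elim: set_plus_elim)
  with w that show thesis by simp
qed

lemma gradient_component_bound:
  fixes f :: "real ^ 'n \<Rightarrow> ereal"
  assumes f: "unit_box \<subseteq> U" "continuously_differentiable_on U f"
    and c: "c > 0" and \<mu>: "\<mu> > mu_bar f c" and x: "x \<in> unit_box"
  shows "\<bar>gradient f x $ i\<bar> < \<mu> * c"
proof -
  have "continuous_on unit_box (\<lambda>x. infnorm (gradient f x))"
    using f by (auto simp: continuously_differentiable_on_def
        intro!: continuous_on_infnorm intro: continuous_on_subset)
  then have "compact ((\<lambda>x. infnorm (gradient f x)) ` (unit_box :: (real ^ 'n) set))"
    by (rule compact_continuous_image) (simp add: unit_box_eq_cbox)
  then have "bdd_above ((\<lambda>x. infnorm (gradient f x)) ` (unit_box :: (real ^ 'n) set))"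
    by (simp add: compact_imp_bounded bounded_imp_bdd_above)
  then have "infnorm (gradient f x) \<le> (SUP x\<in>unit_box. infnorm (gradient f x))"
    using x by (rule cSUP_upper[rotated])
  moreover have "(SUP x\<in>unit_box. infnorm (gradient f x)) < \<mu> * c"
    using \<mu> c by (simp add: mu_bar_def field_simps)
  ultimately show ?thesis using component_le_infnorm_cart[of "gradient f x" i] by linarith
qed

section \<open>Sharp-peak penalties\<close>

text \<open>
  Convergence of the sums \<open>separable_sum g (X k)\<close> does not by itself make the single terms
  \<open>g (X k $ i)\<close> converge, so \<open>v $ i\<close> is not shown to be a limiting subgradient of \<open>g\<close> at \<open>x $ i\<close>.  Instead
  the lower bound is used at the approximating points, whose \<open>i\<close>-th coordinates eventually lie in the
  interval, and is carried over to the limit.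
\<close>

lemma sharp_peak_subgradient_interior:
  fixes x v :: "real ^ 'n"
  assumes g: "sharp_peak g c" and v: "v \<in> subdifferential (separable_sum g) x"
    and i: "0 < x $ i" "x $ i < 1"
  shows "c \<le> \<bar>v $ i\<bar>"
proof -
  obtain X V where XV: "X \<longlonglongrightarrow> x" "V \<longlonglongrightarrow> v"
      and reg: "\<And>k. V k \<in> regular_subdifferential (separable_sum g) (X k)"
    using v unfolding subdifferential_def by blast
  have "(\<lambda>k. X k $ i) \<longlonglongrightarrow> x $ i" using XV(1) by (rule tendsto_vec_nth)
  with i have "\<forall>\<^sub>F k in sequentially. X k $ i > 0" "\<forall>\<^sub>F k in sequentially. X k $ i < 1"
    by (auto dest: order_tendstoD)
  then have "\<forall>\<^sub>F k in sequentially. c \<le> \<bar>V k $ i\<bar>"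
  proof eventually_elim
    case (elim k)
    have "V k $ i \<in> subdifferential g (X k $ i)"
      using regular_subdifferential_separable_sum_component[OF _ reg] g
        regular_subdifferential_subset by (fastforce simp: sharp_peak_def)
    with elim g show ?case by (auto simp: sharp_peak_def)
  qed
  moreover have "(\<lambda>k. \<bar>V k $ i\<bar>) \<longlonglongrightarrow> \<bar>v $ i\<bar>"
    using XV(2) by (intro tendsto_rabs tendsto_vec_nth)
  ultimately show ?thesis by (intro tendsto_lowerbound) auto
qed

text \<open>
  At the two end points this is the sum rule in the definition of a sharp peak; strictly between them
  the indicator vanishes nearby, and the normal part is 0.
\<close>

lemma sharp_peak_regular_subgradient_decompose:
  assumes g: "sharp_peak g c" and t: "t \<in> {0..1}"
    and u: "u \<in> regular_subdifferential (\<lambda>t. g t + indicator_fun {0..1} t) t"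
  shows "u \<in> subdifferential g t + normal_cone {0..1} t"
proof (cases "t \<in> {0, 1}")
  case True
  with g u regular_subdifferential_subset show ?thesis
    unfolding sharp_peak_def by blast
next
  case False
  with t have "t \<in> {0<..<1}" by auto
  then have "\<forall>\<^sub>F s in nhds t. s \<in> {0<..<1}" by (intro eventually_nhds_in_open) auto
  then have "\<forall>\<^sub>F s in nhds t. g s + indicator_fun {0..1} s = g s"
    by eventually_elim (simp add: indicator_fun_def)
  from regular_subdifferential_eventually_cong[OF this] u have "u \<in> subdifferential g t"
    using regular_subdifferential_subset by auto
  moreover have "0 \<in> normal_cone {0..1} t" using t by (simp add: normal_cone_def)
  ultimately show ?thesis by (metis add.right_neutral set_plus_intro)
qed

section \<open>KKT points versus local minimizers\<close>

lemma KKT_point_binary: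
  fixes f :: "real ^ 'n \<Rightarrow> ereal"
  assumes f: "unit_box \<subseteq> U" "continuously_differentiable_on U f"
    and g: "sharp_peak g c" and \<mu>: "\<mu> > mu_bar f c"
    and kkt: "KKT_point f (separable_sum g) \<mu> x"
  shows "x $ i \<in> {0, 1}"
proof (rule ccontr)
  assume "x $ i \<notin> {0, 1}"
  have x: "x \<in> unit_box" using kkt by (simp add: KKT_point_def)
  with \<open>x $ i \<notin> {0, 1}\<close> have i: "0 < x $ i" "x $ i < 1"
    by (auto simp: unit_box_def less_le)
  obtain v w where v: "v \<in> subdifferential (separable_sum g) x"
    and w: "w \<in> normal_cone unit_box x" and sum0: "gradient f x + \<mu> *\<^sub>R v + w = 0"
    using kkt by (rule KKT_pointE)
  have c: "c > 0" using g by (simp add: sharp_peak_def)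
  have bound: "\<bar>gradient f x $ i\<bar> < \<mu> * c"
    using gradient_component_bound[OF f c \<mu> x] .
  then have "\<mu> * c > 0" by linarith
  then have "\<mu> > 0" using c by (simp add: zero_less_mult_iff)
  have "w $ i = 0"
    using normal_cone_interior_unit_interval[OF i] w by (simp add: normal_cone_unit_box_iff)
  moreover have "gradient f x $ i + \<mu> * v $ i + w $ i = 0"
    using arg_cong[OF sum0, of "\<lambda>z. z $ i"] by simp
  ultimately have "\<bar>gradient f x $ i\<bar> = \<mu> * \<bar>v $ i\<bar>"
    using \<open>\<mu> > 0\<close> by (simp add: eq_neg_iff_add_eq_0[symmetric] abs_mult)
  moreover have "\<mu> * c \<le> \<mu> * \<bar>v $ i\<bar>"
    using sharp_peak_subgradient_interior[OF g v i] \<open>\<mu> > 0\<close> by simp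
  ultimately show False using bound by simp
qed

lemma convex_KKT_point_local_minimizer:
  fixes f :: "real ^ 'n \<Rightarrow> ereal"
  assumes f: "continuously_differentiable_on U f" "x \<in> U" and "\<mu> > 0"
    and kkt: "KKT_point f \<phi> \<mu> x"
    and conv: "locally_convex_around f x" "locally_convex_around \<phi> x"
  shows "local_minimizer_on unit_box (penalized f \<phi> \<mu>) x"
proof -
  obtain S where S: "open S" "x \<in> S" "ereal_convex_on S f"
    using conv(1) unfolding locally_convex_around_def by blast
  obtain T where T: "open T" "x \<in> T" "ereal_convex_on T \<phi>"
    using conv(2) unfolding locally_convex_around_def by blast
  obtain v w where v: "v \<in> subdifferential \<phi> x"
    and w: "w \<in> normal_cone unit_box x" and sum0: "gradient f x + \<mu> *\<^sub>R v + w = 0"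
    using kkt by (rule KKT_pointE)
  have grad: "gradient f x \<in> subdifferential f x"
    using gradient_in_regular_subdifferential[OF f] regular_subdifferential_subset by blast
  obtain a where a: "f x = ereal a"
    using grad unfolding subdifferential_def by (cases "f x") auto
  obtain p where p: "\<phi> x = ereal p"
    using v unfolding subdifferential_def by (cases "\<phi> x") auto
  have le: "penalized f \<phi> \<mu> x \<le> penalized f \<phi> \<mu> y" if y: "y \<in> S" "y \<in> T" "y \<in> unit_box" for y
  proof -
    have fy: "ereal (a + gradient f x \<bullet> (y - x)) \<le> f y"
      using subgradient_inequality[OF S(3,1,2) y(1) grad] a by simp
    have "ereal (p + v \<bullet> (y - x)) \<le> \<phi> y"
      using subgradient_inequality[OF T(3,1,2) y(2) v] p by simp
    then have \<phi>y: "ereal \<mu> * ereal (p + v \<bullet> (y - x)) \<le> ereal \<mu> * \<phi> y"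
      using \<open>\<mu> > 0\<close> by (intro ereal_mult_left_mono) auto
    have "gradient f x \<bullet> (y - x) + \<mu> * (v \<bullet> (y - x)) + w \<bullet> (y - x) = 0"
      using arg_cong[OF sum0, of "\<lambda>z. z \<bullet> (y - x)"] by (simp add: inner_add_left)
    moreover have "w \<bullet> (y - x) \<le> 0" using w y(3) by (simp add: normal_cone_def)
    ultimately have "a + \<mu> * p \<le> (a + gradient f x \<bullet> (y - x)) + \<mu> * (p + v \<bullet> (y - x))"
      by (simp add: algebra_simps)
    then have "penalized f \<phi> \<mu> x
        \<le> ereal (a + gradient f x \<bullet> (y - x)) + ereal \<mu> * ereal (p + v \<bullet> (y - x))"
      by (simp add: penalized_def a p)
    also have "\<dots> \<le> penalized f \<phi> \<mu> y"
      unfolding penalized_def using fy \<phi>y by (rule add_mono)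
    finally show ?thesis .
  qed
  have "\<forall>\<^sub>F y in nhds x. y \<in> S \<inter> T"
    using S T by (intro eventually_nhds_in_open) auto
  then have "\<forall>\<^sub>F y in at x within unit_box. penalized f \<phi> \<mu> x \<le> penalized f \<phi> \<mu> y"
    unfolding eventually_at_filter by eventually_elim (simp add: le)
  moreover have "x \<in> unit_box" using kkt by (simp add: KKT_point_def)
  ultimately show ?thesis
    by (simp add: local_minimizer_on_def penalized_def a p)
qed

lemma local_minimizer_KKT_point:
  fixes f :: "real ^ 'n \<Rightarrow> ereal"
  assumes f: "continuously_differentiable_on U f" "x \<in> U" and "\<mu> > 0"
    and g: "sharp_peak g c"
    and min: "local_minimizer_on unit_box (penalized f (separable_sum g) \<mu>) x"
  shows "KKT_point f (separable_sum g) \<mu> x"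
proof -
  have x: "x \<in> unit_box" using min by (simp add: local_minimizer_on_def)
  have g_minf: "g t \<noteq> -\<infinity>" for t using g by (simp add: sharp_peak_def)
  let ?h = "\<lambda>t. g t + indicator_fun {0..1} t"
  have h: "?h t \<noteq> -\<infinity>" for t using g_minf[of t] by (cases "g t") (auto simp: indicator_fun_def)
  have "- (gradient f x /\<^sub>R \<mu>) \<in> regular_subdifferential (separable_sum ?h) x"
    using regular_subdifferential_at_local_minimizer[OF f \<open>\<mu> > 0\<close> min]
    by (simp add: separable_sum_add_indicator_unit_box[where g = g, OF g_minf])
  from regular_subdifferential_separable_sum_component[where g = ?h, OF h this]
  have comp: "- (gradient f x $ i / \<mu>) \<in> regular_subdifferential ?h (x $ i)" for i
    by (simp add: divide_inverse mult.commute)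
  have "- (gradient f x $ i / \<mu>) \<in> subdifferential g (x $ i) + normal_cone {0..1} (x $ i)" for i
    by (rule sharp_peak_regular_subgradient_decompose[OF g _ comp])
      (use x in \<open>simp add: unit_box_def\<close>)
  then have "\<exists>u n. u \<in> subdifferential g (x $ i) \<and> n \<in> normal_cone {0..1} (x $ i) \<and>
      - (gradient f x $ i / \<mu>) = u + n" for i
    using set_plus_elim by metis
  then obtain u n where u: "\<And>i. u i \<in> subdifferential g (x $ i)"
    and n: "\<And>i. n i \<in> normal_cone {0..1} (x $ i)"
    and un: "\<And>i. - (gradient f x $ i / \<mu>) = u i + n i"
    by metis
  have "(\<chi> i. u i) \<in> subdifferential (separable_sum g) x"
    by (rule subdifferential_separable_sum_vec) (simp add: u)
  then have v: "\<mu> *\<^sub>R (\<chi> i. u i) \<in> (\<lambda>v. \<mu> *\<^sub>R v) ` subdifferential (separable_sum g) x"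
    by (rule imageI)
  have "\<mu> * n i \<in> normal_cone {0..1} (x $ i)" for i
    using n[of i] \<open>\<mu> > 0\<close> by (simp add: normal_cone_def mult.assoc mult_nonneg_nonpos)
  then have w: "\<mu> *\<^sub>R (\<chi> i. n i) \<in> normal_cone unit_box x"
    by (simp add: normal_cone_unit_box_iff)
  have "gradient f x $ i + \<mu> * u i + \<mu> * n i = 0" for i
    using un[of i] \<open>\<mu> > 0\<close> by (simp add: field_simps)
  then have "gradient f x + \<mu> *\<^sub>R (\<chi> i. u i) + \<mu> *\<^sub>R (\<chi> i. n i) = 0"
    by (simp add: vec_eq_iff)
  with set_plus_intro[OF set_plus_intro[OF singletonI v] w, of "gradient f x"] x
  show ?thesis by (simp add: KKT_point_def)
qed

theorem theorem3p1:
  fixes f :: "real ^ 'n \<Rightarrow> ereal" and g :: "real \<Rightarrow> ereal" and c \<mu> :: real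
    and U :: "(real ^ 'n) set"
  assumes "\<And>x. f x \<noteq> -\<infinity>"
    and "unit_box \<subseteq> U" and "continuously_differentiable_on U f"
    and "sharp_peak g c"
    and "\<mu> > mu_bar f c"
  shows "(\<forall>x. KKT_point f (separable_sum g) \<mu> x \<longrightarrow> (\<forall>i. x $ i \<in> {0, 1}))
    \<and> (\<forall>x. KKT_point f (separable_sum g) \<mu> x \<longrightarrow>
            locally_convex_around f x \<longrightarrow> locally_convex_around (separable_sum g) x \<longrightarrow>
            local_minimizer_on unit_box (penalized f (separable_sum g) \<mu>) x)
    \<and> (\<forall>x. local_minimizer_on unit_box (penalized f (separable_sum g) \<mu>) x \<longrightarrow>
            KKT_point f (separable_sum g) \<mu> x)"
proof -
  note f = assms(2,3) and g = assms(4) and \<mu> = assms(5)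
  have c: "c > 0" using g by (simp add: sharp_peak_def)
  \<comment> \<open>Evaluating the gradient bound at any point of the box shows that \<open>\<mu>\<close> is positive.\<close>
  have "(0 :: real ^ 'n) \<in> unit_box" by (simp add: unit_box_def)
  from gradient_component_bound[OF f c \<mu> this] have "\<mu> * c > 0"
    by (meson abs_ge_zero le_less_trans)
  then have pos: "\<mu> > 0" using c by (simp add: zero_less_mult_iff)
  have U: "x \<in> U" if "x \<in> unit_box" for x using that f(1) by blast
  show ?thesis
  proof (intro conjI allI impI)
    fix x i assume "KKT_point f (separable_sum g) \<mu> x"
    then show "x $ i \<in> {0, 1}" by (rule KKT_point_binary[OF f g \<mu>])
  next
    fix x assume "KKT_point f (separable_sum g) \<mu> x"
      and "locally_convex_around f x" "locally_convex_around (separable_sum g) x"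
    then show "local_minimizer_on unit_box (penalized f (separable_sum g) \<mu>) x"
      using convex_KKT_point_local_minimizer[OF f(2) U pos] by (simp add: KKT_point_def)
  next
    fix x assume min: "local_minimizer_on unit_box (penalized f (separable_sum g) \<mu>) x"
    then have "x \<in> U" using U by (simp add: local_minimizer_on_def)
    then show "KKT_point f (separable_sum g) \<mu> x"
      using local_minimizer_KKT_point[OF f(2) _ pos g min] by simp
  qed
qed

end
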